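(* For every $n\ge3$, $$\min_{S\in\mathcal{G}_n}|K_S|=5,$$ and the minimum is uniquely achieved by the sequence $L_n=(2,3,5,7,\ldots,2n-1)$.
   Context: For a finite integer sequence $S=(s_1,\ldots,s_n)$, its difference triangle is defined by $s_a^0:=s_a$ and $s_a^b:=|s_{a+1}^{b-1}-s_a^{b-1}|$ for $b\ge 1$, $1\le a\le n-b$ (superscripts are row indices, not powers). $S$ is Gilbreath if $s_1^b=1$ for every $1\le b\le n-1$. For $n\ge 2$, $\mathcal{G}_n$ is the set of strictly increasing Gilbreath integer sequences $(s_1,\ldots,s_n)$ of length $n$ with $(s_1,s_2)=(2,3)$. The valid-extension set of $S$ is $K_S:=\{k\in\mathbb{Z}:(s_1,\ldots,s_n,k)\text{ is Gilbreath}\}$. $L_n$ denotes the length-$n$ sequence with first term $2$ and $i$-th term $2i-1$ for $2\le i\le n$. *)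

theory Defs
  imports Complex_Main
begin

(* Row b, column a of the difference triangle of S. Columns are counted from 1;
   the entry is meaningful only for 1 <= a and a + b <= length S. *)
fun diff_tri :: "int list \<Rightarrow> nat \<Rightarrow> nat \<Rightarrow> int" where
  "diff_tri S 0 a = S ! (a - 1)"
| "diff_tri S (Suc b) a = \<bar>diff_tri S b (a + 1) - diff_tri S b a\<bar>"

definition gilbreath :: "int list \<Rightarrow> bool" where
  "gilbreath S \<longleftrightarrow> (\<forall>b. 1 \<le> b \<and> b < length S \<longrightarrow> diff_tri S b 1 = 1)"

definition gilbreath_seqs :: "nat \<Rightarrow> int list set" where
  "gilbreath_seqs n =
     {S. length S = n \<and> sorted_wrt (<) S \<and> gilbreath S \<and> take 2 S = [2, 3]}"

definition valid_exts :: "int list \<Rightarrow> int set" where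
  "valid_exts S = {k. gilbreath (S @ [k])}"

definition odd_seq :: "nat \<Rightarrow> int list" where
  "odd_seq n = map (\<lambda>i. if i = 1 then 2 else 2 * int i - 1) [1..<Suc n]"

end

theory Submission
  imports Defs
begin

text \<open>
  Appending \<open>k\<close> to \<open>S\<close> adds one antidiagonal \<open>e\<close> to the triangle, computed from the last
  antidiagonal \<open>d\<close> of \<open>S\<close> by \<open>e\<^sub>0 = k\<close> and \<open>e\<^sub>j\<^sub>+\<^sub>1 = \<bar>e\<^sub>j - d\<^sub>j\<bar>\<close>; the extension is valid iff \<open>e\<close>
  ends in 1. For a Gilbreath sequence all entries of \<open>d\<close> other than \<open>d\<^sub>0\<close> and the final 1 are
  even, and \<open>d\<^sub>1 \<ge> 2\<close> by monotonicity. Running the recursion backwards, the admissible values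
  of the penultimate entry of \<open>e\<close> are 0 and 2; zeros of \<open>d\<close> keep this set, and the first nonzero
  \<open>d\<^sub>j\<close> met turns it into the three-element set \<open>{d\<^sub>j - 2, d\<^sub>j, d\<^sub>j + 2}\<close>, after which the cardinality
  never drops. If this happens at some \<open>j \<ge> 2\<close>, or if \<open>d\<^sub>1 > 2\<close>, then \<open>e\<^sub>1\<close> has three positive
  admissible values, giving six valid \<open>k\<close>. Otherwise \<open>d = (s\<^sub>n, 2, 0, \<dots>, 0, 1)\<close>, which yields
  exactly five values and, peeling off antidiagonals, determines \<open>S\<close>.
\<close>

section \<open>Antidiagonals and one-term extensions\<close>

fun scan :: "int list \<Rightarrow> int \<Rightarrow> int list" where
  "scan [] x = [x]"
| "scan (d # ds) x = x # scan ds \<bar>x - d\<bar>"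

definition antidiag :: "int list \<Rightarrow> int list" where
  "antidiag S = map (\<lambda>j. diff_tri S j (length S - j)) [0..<length S]"

text \<open>Only nonnegative starting values matter below the top row, where entries are absolute
  values; the appended term itself may be any integer and is treated separately.\<close>

definition feasible :: "int list \<Rightarrow> int set" where
  "feasible ds = {x. 0 \<le> x \<and> last (scan ds x) = 1}"

lemma length_scan [simp]: "length (scan ds x) = Suc (length ds)"
  by (induction ds arbitrary: x) auto

lemma scan_neq_Nil [simp]: "scan ds x \<noteq> []"
  by (cases ds) auto

lemma scan_nth_0 [simp]: "scan ds x ! 0 = x"
  by (cases ds) auto

lemma scan_nth_Suc: "j < length ds \<Longrightarrow> scan ds x ! Suc j = \<bar>scan ds x ! j - ds ! j\<bar>"
proof (induction ds arbitrary: x j)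
  case (Cons d ds)
  then show ?case by (cases j) auto
qed simp

lemma length_antidiag [simp]: "length (antidiag S) = length S"
  by (simp add: antidiag_def)

lemma antidiag_nth: "j < length S \<Longrightarrow> antidiag S ! j = diff_tri S j (length S - j)"
  by (simp add: antidiag_def)

lemma diff_tri_append:
  "1 \<le> a \<Longrightarrow> a + b \<le> length S \<Longrightarrow> diff_tri (S @ T) b a = diff_tri S b a"
  by (induction b arbitrary: a) (auto simp: nth_append)

lemma diff_tri_nonneg: "1 \<le> b \<Longrightarrow> 0 \<le> diff_tri S b a"
  by (cases b) auto

text \<open>Each new entry is the distance between the new entry one row above and its left
  neighbour, which lies in the old triangle and ends its row there.\<close>

lemma antidiag_snoc: "antidiag (S @ [k]) = scan (antidiag S) k"
proof (rule nth_equalityI)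
  fix j assume "j < length (antidiag (S @ [k]))"
  then have "j \<le> length S" by simp
  then show "antidiag (S @ [k]) ! j = scan (antidiag S) k ! j"
  proof (induction j)
    case 0
    then show ?case by (simp add: antidiag_nth)
  next
    case (Suc j)
    have IH: "diff_tri (S @ [k]) j (Suc (length S) - j) = scan (antidiag S) k ! j"
      using Suc by (simp add: antidiag_nth)
    have "diff_tri (S @ [k]) j (length S - j) = antidiag S ! j"
      using Suc.prems by (subst diff_tri_append) (auto simp: antidiag_nth)
    moreover have "Suc (length S - j) = Suc (length S) - j"
      using Suc.prems by simp
    ultimately show ?case
      using Suc.prems IH by (simp add: antidiag_nth scan_nth_Suc)
  qed
qed simp

lemma last_antidiag: "S \<noteq> [] \<Longrightarrow> last (antidiag S) = diff_tri S (length S - 1) 1"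
  by (cases S rule: rev_cases) (simp_all add: antidiag_def)

text \<open>The left edge gains exactly one entry, the end of the new antidiagonal; all earlier edge
  entries are those of \<open>S\<close>.\<close>

lemma gilbreath_snoc:
  assumes "S \<noteq> []"
  shows "gilbreath (S @ [k]) \<longleftrightarrow> gilbreath S \<and> last (scan (antidiag S) k) = 1"
proof -
  have "last (scan (antidiag S) k) = diff_tri (S @ [k]) (length S) 1"
    using last_antidiag[of "S @ [k]"] by (simp add: antidiag_snoc)
  moreover have "diff_tri (S @ [k]) b 1 = diff_tri S b 1" if "b < length S" for b
    using that by (intro diff_tri_append) auto
  ultimately show ?thesis
    using assms by (auto simp: gilbreath_def less_Suc_eq Suc_le_eq)
qed

lemma valid_exts_conv:
  "gilbreath S \<Longrightarrow> S \<noteq> [] \<Longrightarrow> valid_exts S = {k. last (scan (antidiag S) k) = 1}"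
  by (simp add: valid_exts_def gilbreath_snoc)

section \<open>Parity and the shape of the last antidiagonal\<close>

lemma even_diff_tri:
  assumes "gilbreath S" "2 \<le> a" "1 \<le> b" "a + b \<le> length S"
  shows "even (diff_tri S b a)"
proof -
  have edge: "diff_tri S b 1 = 1" if "1 \<le> b" "b < length S" for b
    using assms(1) that by (simp add: gilbreath_def)
  show ?thesis
    using assms(2-)
  proof (induction a arbitrary: b rule: dec_induct)
    case base
    \<comment> \<open>In column 2, two consecutive edge entries equal to 1 leave only the values 0
      and 2.\<close>
    have b1: "diff_tri S b 1 = 1" and Sb1: "diff_tri S (Suc b) 1 = 1"
      using edge[of b] edge[of "Suc b"] base by (simp_all del: diff_tri.simps)
    have "\<bar>diff_tri S b (1 + 1) - 1\<bar> = 1"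
      using Sb1 unfolding diff_tri.simps b1 .
    then have "\<bar>diff_tri S b 2 - 1\<bar> = 1"
      unfolding one_add_one .
    then have "diff_tri S b 2 = 0 \<or> diff_tri S b 2 = 2"
      by linarith
    then show ?case by auto
  next
    case (step a)
    \<comment> \<open>Up to sign, the entry to the right in row \<open>b\<close> is the sum or
      difference of these two even numbers.\<close>
    have "even (diff_tri S b a)" "even (diff_tri S (Suc b) a)"
      using step.IH[of b] step.IH[of "Suc b"] step.prems step.hyps by (simp_all del: diff_tri.simps)
    then show ?case by simp
  qed
qed

lemma antidiag_gilbreath_seqs:
  assumes "S \<in> gilbreath_seqs n" "n \<ge> 3"
  obtains d zs where "antidiag S = last S # d # zs @ [1]" "length zs = n - 3"
    "\<forall>z\<in>set zs. 0 \<le> z \<and> even z" "2 \<le> d" "even d"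
proof -
  have len: "length S = n" and sorted: "sorted_wrt (<) S" and gil: "gilbreath S"
    using assms by (auto simp: gilbreath_seqs_def)
  define D where "D = antidiag S"
  have lenD: "length D = n" by (simp add: D_def len)
  \<comment> \<open>The bounds on \<open>j\<close> leave out the top row and the edge: the entry
    lies in column \<open>n - j\<close>, which is at least 2.\<close>
  have entry: "0 \<le> D ! j \<and> even (D ! j)" if "1 \<le> j" "j < n - 1" for j
    using that len gil by (auto simp: D_def antidiag_nth intro!: diff_tri_nonneg even_diff_tri)
  have D0: "D ! 0 = last S"
  proof -
    have "S \<noteq> []" using assms(2) len by auto
    then show ?thesis by (simp add: D_def antidiag_nth last_conv_nth)
  qed
  have "last D = 1"
    using assms(2) len gil by (subst D_def, subst last_antidiag) (auto simp: gilbreath_def)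
  obtain d0 d ys where ys: "D = d0 # d # ys" "ys \<noteq> []"
    using lenD assms(2) by (cases D; cases "tl D"; cases "tl (tl D)") auto
  define zs where "zs = butlast ys"
  have D: "D = d0 # d # zs @ [1]"
    using ys \<open>last D = 1\<close> append_butlast_last_id[of ys] by (simp add: zs_def)
  have len_zs: "length zs = n - 3" using D lenD by simp
  have "0 \<le> z \<and> even z" if z: "z \<in> set zs" for z
  proof -
    obtain i where "i < length zs" "zs ! i = z"
      using z by (auto simp: in_set_conv_nth)
    then show ?thesis
      using entry[of "i + 2"] len_zs D by (simp add: nth_append)
  qed
  moreover have "even d" using entry[of 1] D assms(2) by simp
  moreover have "2 \<le> d"
  proof -
    have "S ! (n - 2) < S ! (n - 1)"
      using sorted len assms(2) by (simp add: sorted_wrt_iff_nth_less)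
    moreover have "d = \<bar>S ! (n - 1) - S ! (n - 2)\<bar>"
    proof -
      have "d = antidiag S ! 1" using D by (simp flip: D_def)
      then show ?thesis
        using len assms(2) by (simp add: antidiag_nth numeral_2_eq_2)
    qed
    ultimately have "d > 0" by simp
    then show ?thesis using \<open>even d\<close> by presburger
  qed
  ultimately show ?thesis
    using that[of d zs] D D0 len_zs by (simp add: D_def)
qed

section \<open>Counting admissible values\<close>

lemma feasible_Nil: "feasible [] = {1}"
  by (auto simp: feasible_def)

lemma feasible_Cons: "feasible (d # ds) = {x. 0 \<le> x \<and> \<bar>x - d\<bar> \<in> feasible ds}"
  by (auto simp: feasible_def)

lemma finite_abs_preimage:
  fixes d :: int
  assumes "finite A"
  shows "finite {x. \<bar>x - d\<bar> \<in> A}"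
proof (rule finite_subset)
  show "{x. \<bar>x - d\<bar> \<in> A} \<subseteq> (\<lambda>a. d + a) ` A \<union> (\<lambda>a. d - a) ` A"
  proof
    fix x assume "x \<in> {x. \<bar>x - d\<bar> \<in> A}"
    moreover have "x = d + \<bar>x - d\<bar> \<or> x = d - \<bar>x - d\<bar>" by linarith
    ultimately show "x \<in> (\<lambda>a. d + a) ` A \<union> (\<lambda>a. d - a) ` A" by blast
  qed
qed (use assms in auto)

lemma finite_feasible: "finite (feasible ds)"
proof (induction ds)
  case (Cons d ds)
  then show ?case
    using finite_subset[OF _ finite_abs_preimage[OF Cons, of d]]
    by (auto simp: feasible_Cons)
qed (simp add: feasible_Nil)

text \<open>Starting at \<open>d + x\<close> with \<open>x\<close> nonnegative, the first step of
  the scan returns to \<open>x\<close>.\<close>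

lemma feasible_shift: "0 \<le> d \<Longrightarrow> (\<lambda>x. d + x) ` feasible ds \<subseteq> feasible (d # ds)"
  by (auto simp: feasible_Cons) (auto simp: feasible_def)

lemma card_feasible_mono: "0 \<le> d \<Longrightarrow> card (feasible ds) \<le> card (feasible (d # ds))"
  using card_mono[OF finite_feasible feasible_shift, of d ds] by (simp add: card_image)

lemma feasible_zeros: "\<forall>z\<in>set zs. z = 0 \<Longrightarrow> feasible (zs @ [1]) = {0, 2}"
proof (induction zs)
  case Nil
  then show ?case by (auto simp: feasible_Cons feasible_Nil)
qed (auto simp: feasible_Cons)

lemma feasible_Cons_zeros:
  "\<forall>z\<in>set zs. z = 0 \<Longrightarrow> 2 \<le> d \<Longrightarrow> feasible (d # zs @ [1]) = {d - 2, d, d + 2}"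
  by (auto simp: feasible_Cons feasible_zeros)

text \<open>The last nonzero entry is even, hence at least 2, and only zeros separate it from the
  final 1, so it yields three values; prepending further entries cannot lower the count.\<close>

lemma card_feasible_ge_3:
  assumes "\<forall>z\<in>set zs. 0 \<le> z \<and> even z" "\<exists>z\<in>set zs. z \<noteq> 0"
  shows "3 \<le> card (feasible (zs @ [1]))"
  using assms
proof (induction zs)
  case (Cons d zs)
  show ?case
  proof (cases "\<exists>z\<in>set zs. z \<noteq> 0")
    case True
    then show ?thesis
      using Cons card_feasible_mono[of d "zs @ [1]"] by auto
  next
    case False
    then have "d \<noteq> 0" "0 \<le> d" "even d" using Cons.prems by auto
    then have "2 \<le> d" by presburger
    then show ?thesis using False by (simp add: feasible_Cons_zeros)
  qed
qed simp

text \<open>A positive \<open>x\<close> has the two preimages \<open>d + x\<close> and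
  \<open>d - x\<close>, on opposite sides of \<open>d\<close>. The subset \<open>P\<close> serves to
  discard a possible 0 in \<open>A\<close>, which has only one preimage.\<close>

lemma card_abs_preimage_ge:
  fixes d :: int
  assumes "finite A" "P \<subseteq> A" "\<forall>x\<in>P. 0 < x"
  shows "2 * card P \<le> card {k. \<bar>k - d\<bar> \<in> A}"
proof -
  have fin: "finite P" using assms finite_subset by blast
  have "card ((\<lambda>x. d + x) ` P \<union> (\<lambda>x. d - x) ` P) = card ((\<lambda>x. d + x) ` P) + card ((\<lambda>x. d - x) ` P)"
  proof (intro card_Un_disjoint)
    have False if "x \<in> P" "y \<in> P" "d + x = d - y" for x y
    proof -
      have "0 < x" "0 < y" using that assms(3) by auto
      then show False using that(3) by linarith
    qed
    then show "(\<lambda>x. d + x) ` P \<inter> (\<lambda>x. d - x) ` P = {}" by blast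
  qed (use fin in auto)
  also have "\<dots> = 2 * card P"
    by (simp add: card_image inj_on_def)
  finally have "2 * card P = card ((\<lambda>x. d + x) ` P \<union> (\<lambda>x. d - x) ` P)" ..
  also have "\<dots> \<le> card {k. \<bar>k - d\<bar> \<in> A}"
    using assms by (intro card_mono finite_abs_preimage) (auto simp: subset_iff)
  finally show ?thesis .
qed

lemma card_abs_preimage_feasible:
  assumes "\<forall>z\<in>set zs. 0 \<le> z \<and> even z" "2 \<le> d" "even d"
  shows "if d = 2 \<and> (\<forall>z\<in>set zs. z = 0)
         then card {k. \<bar>k - d0\<bar> \<in> feasible (d # zs @ [1])} = 5
         else 6 \<le> card {k. \<bar>k - d0\<bar> \<in> feasible (d # zs @ [1])}"
proof -
  let ?F = "feasible (d # zs @ [1])"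
  have large: "6 \<le> card {k. \<bar>k - d0\<bar> \<in> ?F}" if "P \<subseteq> ?F" "\<forall>x\<in>P. 0 < x" "3 \<le> card P" for P
    using card_abs_preimage_ge[OF finite_feasible that(1,2), of d0] that(3) by linarith
  consider (five) "d = 2" "\<forall>z\<in>set zs. z = 0" | (zeros) "d \<noteq> 2" "\<forall>z\<in>set zs. z = 0"
    | (nonzero) "\<exists>z\<in>set zs. z \<noteq> 0" by blast
  then show ?thesis
  proof cases
    case five
    \<comment> \<open>Here \<open>?F\<close> is \<open>{0, 2, 4}\<close>; its 0 has a single
      preimage, whence five values instead of six.\<close>
    have "{k. \<bar>k - d0\<bar> \<in> ?F} = {d0 - 4, d0 - 2, d0, d0 + 2, d0 + 4}"
      using five by (auto simp: feasible_Cons_zeros)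
    then show ?thesis using five by simp
  next
    case zeros
    then have "?F = {d - 2, d, d + 2}"
      using assms(2) by (simp add: feasible_Cons_zeros)
    then have "6 \<le> card {k. \<bar>k - d0\<bar> \<in> ?F}"
      using zeros assms(2) by (intro large[of "{d - 2, d, d + 2}"]) auto
    then show ?thesis using zeros by simp
  next
    case nonzero
    \<comment> \<open>Shifting by \<open>d\<close>, which is at least 2, makes all these values
      positive, even one coming from 0.\<close>
    let ?P = "(\<lambda>x. d + x) ` feasible (zs @ [1])"
    have "3 \<le> card ?P"
      using card_feasible_ge_3[OF assms(1) nonzero] by (simp add: card_image)
    moreover have "\<forall>x\<in>?P. 0 < x"
      using assms(2) by (auto simp: feasible_def)
    moreover have "?P \<subseteq> ?F"
      using assms(2) by (intro feasible_shift) simp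
    ultimately show ?thesis using large nonzero by auto
  qed
qed

lemma card_valid_exts:
  assumes "S \<in> gilbreath_seqs n" "n \<ge> 3"
  shows "finite (valid_exts S)"
    and "if antidiag S = last S # 2 # replicate (n - 3) 0 @ [1]
         then card (valid_exts S) = 5 else 6 \<le> card (valid_exts S)"
proof -
  obtain d zs where D: "antidiag S = last S # d # zs @ [1]" "length zs = n - 3"
    "\<forall>z\<in>set zs. 0 \<le> z \<and> even z" "2 \<le> d" "even d"
    using antidiag_gilbreath_seqs[OF assms] .
  have "gilbreath S" "S \<noteq> []"
    using assms by (auto simp: gilbreath_seqs_def)
  then have K: "valid_exts S = {k. \<bar>k - last S\<bar> \<in> feasible (d # zs @ [1])}"
    by (simp add: valid_exts_conv D(1) feasible_def)
  show "finite (valid_exts S)"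
    unfolding K by (intro finite_abs_preimage finite_feasible)
  have "antidiag S = last S # 2 # replicate (n - 3) 0 @ [1] \<longleftrightarrow> d = 2 \<and> (\<forall>z\<in>set zs. z = 0)"
    using D(1,2) by (auto simp: replicate_eqI)
  then show "if antidiag S = last S # 2 # replicate (n - 3) 0 @ [1]
         then card (valid_exts S) = 5 else 6 \<le> card (valid_exts S)"
    using card_abs_preimage_feasible[OF D(3-5), of "last S"] unfolding K by simp
qed

section \<open>The odd sequence and uniqueness\<close>

lemma odd_seq_Suc: "1 \<le> n \<Longrightarrow> odd_seq (Suc n) = odd_seq n @ [2 * int n + 1]"
  by (simp add: odd_seq_def)

lemma odd_seq_3: "odd_seq 3 = [2, 3, 5]"
  by (simp add: odd_seq_def numeral_3_eq_3)

lemma last_odd_seq: "2 \<le> n \<Longrightarrow> last (odd_seq n) = 2 * int n - 1"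
  by (cases n) (auto simp: odd_seq_Suc)

lemma antidiag_3: "antidiag [a, b, c] = [c, \<bar>c - b\<bar>, \<bar>\<bar>c - b\<bar> - \<bar>b - a\<bar>\<bar>]"
  by (simp add: antidiag_def)

text \<open>In an increasing list it suffices to compare \<open>k\<close> with the last term, and
  for \<open>n\<close> at least 2 the prescribed first two terms lie inside
  \<open>S\<close>.\<close>

lemma gilbreath_seqs_snoc:
  assumes "2 \<le> n"
  shows "S @ [k] \<in> gilbreath_seqs (Suc n) \<longleftrightarrow>
    S \<in> gilbreath_seqs n \<and> last S < k \<and> last (scan (antidiag S) k) = 1"
proof (cases "length S = n")
  case True
  then have "S \<noteq> []" using assms by auto
  have "(\<forall>x\<in>set S. x < k) \<longleftrightarrow> last S < k" if "sorted_wrt (<) S"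
    using that \<open>S \<noteq> []\<close> by (induction S rule: rev_induct) (auto simp: sorted_wrt_append)
  then show ?thesis
    using True assms \<open>S \<noteq> []\<close>
    by (auto simp: gilbreath_seqs_def gilbreath_snoc sorted_wrt_append)
next
  case False
  then show ?thesis by (simp add: gilbreath_seqs_def)
qed

lemma scan_zeros: "scan (replicate m 0 @ [1]) 0 = replicate (Suc m) 0 @ [1]"
  by (induction m) auto

lemma scan_eq_zerosD:
  "scan (zs @ [1]) 0 = replicate (Suc (length zs)) 0 @ [1] \<Longrightarrow> \<forall>z\<in>set zs. z = 0"
proof (induction zs)
  case (Cons z zs)
  then have "scan (zs @ [1]) \<bar>z\<bar> = replicate (Suc (length zs)) 0 @ [1]"
    by simp
  moreover from this have "z = 0"
    using scan_nth_0[of "zs @ [1]" "\<bar>z\<bar>"] by simp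
  ultimately show ?case using Cons.IH by simp
qed simp

lemma odd_seq_gilbreath:
  assumes "3 \<le> n"
  shows "odd_seq n \<in> gilbreath_seqs n \<and>
    antidiag (odd_seq n) = last (odd_seq n) # 2 # replicate (n - 3) 0 @ [1]"
  using assms
proof (induction n rule: nat_induct_at_least)
  case base
  have "gilbreath [2, 3, 5]"
    unfolding gilbreath_def
  proof (intro allI impI)
    fix b assume "1 \<le> b \<and> b < length [2, 3, 5 :: int]"
    then have "b = Suc 0 \<or> b = Suc (Suc 0)" by auto
    then show "diff_tri [2, 3, 5] b 1 = 1" by auto
  qed
  then show ?case by (simp add: odd_seq_3 antidiag_3 gilbreath_seqs_def)
next
  case (Suc n)
  \<comment> \<open>The new gap 2 meets the old entry 2 and becomes 0; this 0 passes unchanged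
    through the zeros and turns into 1 at the final 1.\<close>
  have "scan (antidiag (odd_seq n)) (2 * int n + 1) =
      (2 * int n + 1) # 2 # replicate (Suc n - 3) 0 @ [1]"
  proof -
    have "Suc n - 3 = Suc (n - 3)" using Suc.hyps by simp
    then show ?thesis using Suc by (simp add: last_odd_seq scan_zeros)
  qed
  then show ?case
    using Suc by (simp add: odd_seq_Suc gilbreath_seqs_snoc antidiag_snoc last_odd_seq)
qed

text \<open>Removing the last term leaves a sequence whose antidiagonal has the same form, and the
  gap 2 then determines the removed term.\<close>

lemma odd_seq_unique:
  assumes "3 \<le> n" "S \<in> gilbreath_seqs n"
    "antidiag S = last S # 2 # replicate (n - 3) 0 @ [1]"
  shows "S = odd_seq n"
  using assms
proof (induction n arbitrary: S rule: nat_induct_at_least)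
  case base
  have S3: "length S = 3" "take 2 S = [2, 3]" "sorted_wrt (<) S"
    using base.prems(1) unfolding gilbreath_seqs_def by blast+
  have "S = take 2 S @ drop 2 S" by simp
  moreover obtain c where "drop 2 S = [c]"
    using S3(1) by (cases "drop 2 S") (auto dest: arg_cong[of _ _ length])
  ultimately have c: "S = [2, 3, c]" using S3(2) by simp
  have "3 < c" using S3(3) by (simp add: c)
  moreover have "\<bar>c - 3\<bar> = 2"
    using base.prems(2) unfolding c antidiag_3 by simp
  ultimately show ?case by (simp add: c odd_seq_3)
next
  case (Suc n)
  then have "length S = Suc n" by (simp add: gilbreath_seqs_def)
  then obtain T k where S: "S = T @ [k]"
    by (cases S rule: rev_cases) auto
  have T: "T \<in> gilbreath_seqs n" "last T < k"
    using Suc.prems Suc.hyps by (auto simp: S gilbreath_seqs_snoc)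
  obtain d zs where D: "antidiag T = last T # d # zs @ [1]" "length zs = n - 3"
    using antidiag_gilbreath_seqs[OF T(1) Suc.hyps] .
  have rep: "replicate (Suc n - 3) (0 :: int) = replicate (Suc (length zs)) 0"
  proof -
    have "Suc n - 3 = Suc (length zs)" using D(2) Suc.hyps by simp
    then show ?thesis by (rule arg_cong)
  qed
  have eq: "scan (antidiag T) k = k # 2 # replicate (Suc (length zs)) 0 @ [1]"
    using Suc.prems(2) unfolding S antidiag_snoc rep by simp
  \<comment> \<open>The second entry gives \<open>\<bar>k - last T\<bar> = 2\<close>, and
    monotonicity fixes the sign.\<close>
  then have k: "k = last T + 2"
    and sc: "scan (zs @ [1]) \<bar>2 - d\<bar> = replicate (Suc (length zs)) 0 @ [1]"
    using T(2) by (auto simp: D)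
  \<comment> \<open>The scan begins with \<open>\<bar>2 - d\<bar>\<close>, while the list on the
    right begins with 0.\<close>
  have "d = 2"
    using sc scan_nth_0[of "zs @ [1]" "\<bar>2 - d\<bar>"] by simp
  moreover have "\<forall>z\<in>set zs. z = 0"
    using scan_eq_zerosD sc \<open>d = 2\<close> by simp
  ultimately have "antidiag T = last T # 2 # replicate (n - 3) 0 @ [1]"
    using D by (simp add: replicate_eqI)
  then have "T = odd_seq n" using Suc.IH T(1) by blast
  then show ?case
    using k Suc.hyps by (simp add: S odd_seq_Suc last_odd_seq)
qed

theorem theorem25:
  fixes n :: nat
  assumes "n \<ge> 3"
  shows "(\<forall>S \<in> gilbreath_seqs n. finite (valid_exts S)) \<and>
         (INF S \<in> gilbreath_seqs n. card (valid_exts S)) = 5 \<and>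
         {S \<in> gilbreath_seqs n. card (valid_exts S) = 5} = {odd_seq n}"
proof (intro conjI)
  have odd: "odd_seq n \<in> gilbreath_seqs n" "card (valid_exts (odd_seq n)) = 5"
    using odd_seq_gilbreath[OF assms] card_valid_exts(2)[OF _ assms, of "odd_seq n"] by auto
  have other: "6 \<le> card (valid_exts S)" if "S \<in> gilbreath_seqs n" "S \<noteq> odd_seq n" for S
    using card_valid_exts(2)[OF that(1) assms] odd_seq_unique[OF assms that(1)] that(2)
    by (auto split: if_splits)
  show "\<forall>S \<in> gilbreath_seqs n. finite (valid_exts S)"
    using card_valid_exts(1) assms by blast
  show "(INF S \<in> gilbreath_seqs n. card (valid_exts S)) = 5"
  \<comment> \<open>The infimum is a true minimum: \<open>odd_seq n\<close> attains 5 and every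
    other sequence gives at least 6.\<close>
  proof (rule cInf_eq_minimum)
    show "5 \<in> (\<lambda>S. card (valid_exts S)) ` gilbreath_seqs n"
      using odd by force
    show "5 \<le> x" if "x \<in> (\<lambda>S. card (valid_exts S)) ` gilbreath_seqs n" for x
      using that odd other by fastforce
  qed
  show "{S \<in> gilbreath_seqs n. card (valid_exts S) = 5} = {odd_seq n}"
    using odd other by fastforce
qed

end
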